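(* Let $\ell$ be a prime and $n,N$ positive integers with $n^2\mid N$; let $u=\nu_\ell(n)$ and $v=\nu_\ell(N)$. Then for every $e>v$, \[ \#C_{N,n}(\ell^e)=\begin{cases}\ell^{3(e-1)+1}\left(\ell^2-\ell-1-\left(\frac{N-1}{\ell}\right)^2\right)&\text{if }u=0,\ v=0,\\ \ell^{3e-v-2}(\ell+1)(\ell^{v+1}-\ell^v-1)&\text{if }u=0,\ v\ge1,\\ \ell^{3e-v-2}(\ell+1)(\ell^{v-2u+1}-1)&\text{if }1\le u\le v/2,\\ 0&\text{if }0\le v/2<u.\end{cases} \] Consequently, for every $e>v$, \[ \frac{\ell^e\#C_{N,n}(\ell^e)}{\#\mathrm{GL}_2(\mathbb Z/\ell^e\mathbb Z)}=\begin{cases}1-\frac{\left(\frac{N-1}{\ell}\right)^2\ell+1}{(\ell-1)^2(\ell+1)}&\text{if }u=0,\ v=0,\\ \frac{\ell}{\ell-1}\left(1-\frac{1}{\ell^v(\ell-1)}\right)&\text{if }u=0,\ v\ge1,\\ \frac{\ell}{\ell^{2u}(\ell-1)}\left(\frac{\ell^{v+1}-\ell^{2u}}{\ell^{v+1}-\ell^v-1}\right)\left(1-\frac1{\ell^v(\ell-1)}\right)&\text{if }1\le u\le v/2,\\ 0&\text{if }0\le v/2<u.\end{cases} \]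
   Context: $C_{N,n}(\ell^e)=\{\sigma\in\mathrm{GL}_2(\mathbb Z/\ell^e\mathbb Z):\det(\sigma)+1-\mathrm{tr}(\sigma)\equiv N\pmod{\ell^e},\ \sigma\equiv I\pmod{\ell^{\nu_\ell(n)}}\}$, with $I$ the identity matrix and $\nu_\ell$ the $\ell$-adic valuation. $\left(\frac{a}{\ell}\right)^2$ is $1$ if $\ell\nmid a$ and $0$ otherwise. *)

theory Defs
  imports "HOL-Analysis.Determinants" "HOL-Number_Theory.Residues"
begin

text \<open>
  2 by 2 matrices over the ring of integers modulo \<open>m\<close>. As in \<^const>\<open>residue_ring\<close>, a
  residue class is represented by its canonical representative in \<open>{0..m - 1}\<close>, so that
  counting matrices over the residue ring is counting such integer matrices.
\<close>

definition reduce_mat :: "int \<Rightarrow> int^2^2 \<Rightarrow> int^2^2" where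
  "reduce_mat m A = (\<chi> i j. A $ i $ j mod m)"

definition mat2_mod :: "int \<Rightarrow> (int^2^2) monoid" where
  "mat2_mod m =
    \<lparr>carrier = {A. \<forall>i j. A $ i $ j \<in> carrier (residue_ring m)},
     monoid.mult = (\<lambda>A B. reduce_mat m (A ** B)),
     one = reduce_mat m (mat 1)\<rparr>"

definition GL2_mod :: "int \<Rightarrow> (int^2^2) monoid" where
  "GL2_mod m = units_of (mat2_mod m)"

definition C_set :: "nat \<Rightarrow> nat \<Rightarrow> nat \<Rightarrow> nat \<Rightarrow> (int^2^2) set" where
  "C_set N n l e =
    {A \<in> carrier (GL2_mod (int l ^ e)).
       [det A + 1 - trace A = int N] (mod int l ^ e) \<and>
       (\<forall>i j. [A $ i $ j = mat 1 $ i $ j] (mod int l ^ multiplicity l n))}"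

text \<open>
  The square of the symbol \<open>(a/l)\<close>; the prime \<open>l = 2\<close> is allowed.
\<close>

definition symbol_sq :: "int \<Rightarrow> nat \<Rightarrow> int" where
  "symbol_sq a l = (if int l dvd a then 0 else 1)"

lemma group_GL2_mod:
  assumes "m > 0"
  shows "group (GL2_mod m)"
proof -
  have car: "A \<in> carrier (mat2_mod m) \<longleftrightarrow> reduce_mat m A = A" for A
  proof -
    have "x \<in> {0..m - 1} \<longleftrightarrow> x mod m = x" for x :: int
      using assms pos_mod_bound[of m x] pos_mod_sign[of m x]
      by (metis atLeastAtMost_iff mod_pos_pos_trivial zle_diff1_eq)
    then show ?thesis
      by (simp add: mat2_mod_def reduce_mat_def residue_ring_def vec_eq_iff)
  qed
  have idem: "reduce_mat m (reduce_mat m A) = reduce_mat m A" for A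
    by (simp add: reduce_mat_def vec_eq_iff)
  have left: "reduce_mat m (reduce_mat m A ** B) = reduce_mat m (A ** B)" for A B
    by (auto simp: reduce_mat_def matrix_matrix_mult_def vec_eq_iff sum_2 mod_mult_left_eq mod_mult_right_eq
        intro!: mod_add_cong)
  have right: "reduce_mat m (A ** reduce_mat m B) = reduce_mat m (A ** B)" for A B
    by (auto simp: reduce_mat_def matrix_matrix_mult_def vec_eq_iff sum_2 mod_mult_left_eq mod_mult_right_eq
        intro!: mod_add_cong)
  have mult: "A \<otimes>\<^bsub>mat2_mod m\<^esub> B = reduce_mat m (A ** B)"
    and one: "\<one>\<^bsub>mat2_mod m\<^esub> = reduce_mat m (mat 1)" for A B
    by (simp_all add: mat2_mod_def)
  have "monoid (mat2_mod m)"
    by (rule monoidI) (auto simp: car mult one idem left right matrix_mul_assoc)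
  then show ?thesis
    unfolding GL2_mod_def by (rule monoid.units_group)
qed

end

theory Submission
  imports Defs
begin

text \<open>
  Write \<open>A = 1 + B\<close>, so that \<open>det A + 1 - tr A = det B\<close>. Let \<open>D(k, M)\<close> be the number of \<open>B\<close> modulo
  \<open>p^k\<close> with \<open>det B = M\<close>. If \<open>p\<close> does not divide the first row, the second row solves a linear
  congruence with \<open>p^k\<close> solutions; otherwise \<open>p\<close> can be divided out of the first row. Hence
  \<open>D(k+1, M) = p^(3k+1) (p^2 - 1) + [p dvd M] p^2 D(k, M/p)\<close>, which needs no Hensel lifting.
  For \<open>u = 0\<close> one subtracts from \<open>D(e, N)\<close> the matrices \<open>B\<close> with \<open>1 + B\<close> singular modulo \<open>p\<close>; for
  \<open>u \<ge> 1\<close> invertibility is automatic, and dividing \<open>B\<close> by \<open>p^u\<close> leads to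
  \<open>p^(4u) D(e - 2u, N/p^(2u))\<close>. The last case is vacuous, since \<open>n\<^sup>2 dvd N\<close> forces \<open>2u \<le> v\<close>.
\<close>

text \<open>These rules turn sums of indicators into cardinalities or into sums over intersections.
  The counting below works with the indicator sums themselves, which can be split, swapped and
  factored.\<close>

declare sum_of_bool_eq [simp del] sum_of_bool_mult_eq [simp del] sum_mult_of_bool_eq [simp del]

section \<open>Sums of periodic functions over residue systems\<close>

lemma sum_periodic:
  fixes f :: "int \<Rightarrow> int"
  assumes "m > 0" and per: "\<And>x. f (x mod m) = f x"
  shows "(\<Sum>x\<in>{0..<m * int t}. f x) = int t * (\<Sum>x\<in>{0..<m}. f x)"
proof (induction t)
  case 0
  then show ?case by simp
next
  case (Suc t)
  have nn: "0 \<le> m * int t" using assms(1) by simp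
  have "{0..<m * int (Suc t)} = {0..<m * int t} \<union> {m * int t..<m * int t + m}"
    using nn assms(1) by (auto simp only: of_nat_Suc distrib_left mult_1_right set_eq_iff Un_iff atLeastLessThan_iff)
  moreover have "{0..<m * int t} \<inter> {m * int t..<m * int t + m} = {}" by auto
  ultimately have "(\<Sum>x\<in>{0..<m * int (Suc t)}. f x)
      = (\<Sum>x\<in>{0..<m * int t}. f x) + (\<Sum>x\<in>{m * int t..<m * int t + m}. f x)"
    by (simp add: sum.union_disjoint)
  also have "(\<Sum>x\<in>{m * int t..<m * int t + m}. f x) = (\<Sum>x\<in>{0..<m}. f x)"
  proof (rule sum.reindex_bij_witness[of _ "\<lambda>x. x + m * int t" "\<lambda>x. x - m * int t"])
    fix x
    have "f x = f (x mod m)" by (simp add: per)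
    also have "x mod m = (x - m * int t) mod m"
      by (metis mod_mult_self2 diff_add_cancel)
    finally show "f (x - m * int t) = f x" by (simp add: per)
  qed auto
  finally show ?case using Suc.IH by (simp add: algebra_simps)
qed

lemma sum_multiples:
  fixes f :: "int \<Rightarrow> int"
  assumes "d > 0"
  shows "(\<Sum>x\<in>{0..<d * m}. of_bool (d dvd x) * f x) = (\<Sum>x\<in>{0..<m}. f (d * x))"
proof -
  have "(\<Sum>x\<in>{0..<d * m}. of_bool (d dvd x) * f x) = (\<Sum>x\<in>{x\<in>{0..<d * m}. d dvd x}. f x)"
    by (rule sum.mono_neutral_cong_right) auto
  also have "\<dots> = (\<Sum>x\<in>{0..<m}. f (d * x))"
    by (rule sum.reindex_bij_witness[of _ "\<lambda>x. d * x" "\<lambda>x. x div d"])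
      (use assms in \<open>auto elim!: dvdE simp: zero_le_mult_iff\<close>)
  finally show ?thesis .
qed

text \<open>For a unit \<open>a\<close> the map sending \<open>x\<close> to \<open>a * x + c\<close>
  is injective modulo \<open>m\<close>, hence permutes the finite residue system, and
  \<open>f\<close> sees only residues.\<close>

lemma sum_affine:
  fixes f :: "int \<Rightarrow> int"
  assumes "m > 0" and "coprime a m" and per: "\<And>x. f (x mod m) = f x"
  shows "(\<Sum>x\<in>{0..<m}. f (a * x + c)) = (\<Sum>x\<in>{0..<m}. f x)"
proof -
  let ?h = "\<lambda>x. (a * x + c) mod m"
  have "inj_on ?h {0..<m}"
  proof (rule inj_onI)
    fix x y assume xy: "x \<in> {0..<m}" "y \<in> {0..<m}" and "?h x = ?h y"
    then have "[a * x + c = a * y + c] (mod m)" by (simp add: cong_def)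
    then have "[x = y] (mod m)"
      using assms(2) by (simp add: cong_add_rcancel cong_mult_lcancel)
    then show "x = y" using xy by (simp add: cong_def)
  qed
  moreover have "?h ` {0..<m} \<subseteq> {0..<m}" using assms(1) by auto
  ultimately have "bij_betw ?h {0..<m} {0..<m}"
    by (simp add: bij_betw_def endo_inj_surj)
  from sum.reindex_bij_betw[OF this, of f] show ?thesis by (simp add: per)
qed

text \<open>A linear congruence with unit coefficient has one solution in each period, and the range
  consists of \<open>t\<close> periods.\<close>

lemma sum_of_bool_cong:
  fixes a b c m :: int
  assumes "m > 0" and "coprime a m"
  shows "(\<Sum>x\<in>{0..<m * int t}. of_bool ([a * x + b = c] (mod m))) = int t"
proof -
  have "(\<Sum>x\<in>{0..<m}. of_bool ([a * x + b = c] (mod m)) :: int)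
      = (\<Sum>x\<in>{0..<m}. of_bool ([x = c] (mod m)))"
    using sum_affine[OF assms, of "\<lambda>x. of_bool ([x = c] (mod m))" b] by (simp add: cong_def)
  also have "\<dots> = (\<Sum>x\<in>{0..<m}. if x = c mod m then 1 else 0)"
    by (rule sum.cong) (auto simp: cong_def)
  also have "\<dots> = 1" using assms(1) by (simp add: sum.delta)
  finally have 1: "(\<Sum>x\<in>{0..<m}. of_bool ([a * x + b = c] (mod m)) :: int) = 1" .
  show ?thesis
  proof (subst sum_periodic)
    show "of_bool ([a * (x mod m) + b = c] (mod m)) = (of_bool ([a * x + b = c] (mod m)) :: int)" for x
      unfolding cong_def by (metis mod_add_left_eq mod_mult_right_eq)
  qed (use assms(1) 1 in simp_all)
qed

section \<open>Four-fold sums over matrix entries\<close>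

text \<open>A matrix with rows \<open>(x, y)\<close> and \<open>(z, w)\<close> is encoded by its four entries.\<close>

definition quad_sum :: "int \<Rightarrow> (int \<Rightarrow> int \<Rightarrow> int \<Rightarrow> int \<Rightarrow> int) \<Rightarrow> int" where
  "quad_sum m f = (\<Sum>x\<in>{0..<m}. \<Sum>y\<in>{0..<m}. \<Sum>z\<in>{0..<m}. \<Sum>w\<in>{0..<m}. f x y z w)"

text \<open>The range \<open>q\<close> of the entries and the modulus \<open>m\<close> are separate
  parameters, because dividing out powers of \<open>p\<close> lowers the modulus of the determinant
  condition further than the range of the entries.\<close>

definition det_count :: "int \<Rightarrow> int \<Rightarrow> int \<Rightarrow> int" where
  "det_count q m M = quad_sum q (\<lambda>x y z w. of_bool ([x * w - y * z = M] (mod m)))"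

lemma quad_sum_cong:
  assumes "\<And>x y z w. f x y z w = g x y z w"
  shows "quad_sum m f = quad_sum m g"
  using assms by (simp add: quad_sum_def)

lemma quad_sum_periodic:
  assumes "m > 0"
    and "\<And>x y z w. f (x mod m) y z w = f x y z w"
    and "\<And>x y z w. f x (y mod m) z w = f x y z w"
    and "\<And>x y z w. f x y (z mod m) w = f x y z w"
    and "\<And>x y z w. f x y z (w mod m) = f x y z w"
  shows "quad_sum (m * int t) f = int t ^ 4 * quad_sum m f"
  unfolding quad_sum_def
  by (simp add: sum_periodic assms sum_distrib_left[symmetric] power4_eq_xxxx mult.assoc)

lemma quad_sum_multiples:
  assumes "d > 0"
  shows "quad_sum (d * m) (\<lambda>x y z w. of_bool (d dvd x \<and> d dvd y \<and> d dvd z \<and> d dvd w) * f x y z w)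
    = quad_sum m (\<lambda>x y z w. f (d * x) (d * y) (d * z) (d * w))"
  unfolding quad_sum_def
  by (simp add: sum_multiples assms sum_distrib_left[symmetric] of_bool_conj mult.assoc)

text \<open>This is the substitution \<open>A = 1 + B\<close>. Only the diagonal moves, so
  periodicity is asked of \<open>x\<close> and \<open>w\<close>.\<close>

lemma quad_sum_shift:
  assumes "m > 0"
    and "\<And>x y z w. f (x mod m) y z w = f x y z w"
    and "\<And>x y z w. f x y z (w mod m) = f x y z w"
  shows "quad_sum m (\<lambda>x y z w. f (x + 1) y z (w + 1)) = quad_sum m f"
proof -
  have w: "(\<Sum>w\<in>{0..<m}. f x y z (w + 1)) = (\<Sum>w\<in>{0..<m}. f x y z w)" for x y z
    using sum_affine[of m 1 "f x y z" 1] assms by (simp add: add.commute)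
  show ?thesis
    unfolding quad_sum_def w
    using sum_affine[of m 1 "\<lambda>x. \<Sum>y\<in>{0..<m}. \<Sum>z\<in>{0..<m}. \<Sum>w\<in>{0..<m}. f x y z w" 1] assms
    by (simp add: add.commute)
qed

section \<open>Matrices modulo a prime power with prescribed determinant\<close>

lemma cong_cong_lhs: "[a = b] (mod m) \<Longrightarrow> [a = c] (mod m) \<longleftrightarrow> [b = c] (mod m)"
  by (simp add: cong_def)

lemma det_cong_mod:
  fixes m :: int
  shows "[(x mod m) * w - y * z = M] (mod m) \<longleftrightarrow> [x * w - y * z = M] (mod m)"
    and "[x * w - (y mod m) * z = M] (mod m) \<longleftrightarrow> [x * w - y * z = M] (mod m)"
    and "[x * w - y * (z mod m) = M] (mod m) \<longleftrightarrow> [x * w - y * z = M] (mod m)"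
    and "[x * (w mod m) - y * z = M] (mod m) \<longleftrightarrow> [x * w - y * z = M] (mod m)"
  by (rule cong_cong_lhs, intro cong_diff cong_mult cong_refl, simp)+

lemma det_count_periodic:
  assumes "m > 0"
  shows "det_count (m * int t) m M = int t ^ 4 * det_count m m M"
  unfolding det_count_def
  by (rule quad_sum_periodic) (use assms in \<open>simp_all add: det_cong_mod\<close>)

text \<open>The determinant is affine in each entry, and the coefficient is, up to sign, the
  opposite entry. If that is prime to \<open>p\<close>, it is a unit modulo \<open>p ^ k\<close> and
  the entry is determined uniquely.\<close>

lemma det_solve:
  fixes p x y z w M :: int
  assumes "prime p"
  shows "\<not> p dvd x \<Longrightarrow> (\<Sum>w\<in>{0..<p ^ k}. of_bool ([x * w - y * z = M] (mod p ^ k))) = (1::int)"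
    and "\<not> p dvd w \<Longrightarrow> (\<Sum>x\<in>{0..<p ^ k}. of_bool ([x * w - y * z = M] (mod p ^ k))) = (1::int)"
    and "\<not> p dvd y \<Longrightarrow> (\<Sum>z\<in>{0..<p ^ k}. of_bool ([x * w - y * z = M] (mod p ^ k))) = (1::int)"
proof -
  have pos: "p ^ k > 0" using assms by (simp add: prime_gt_0_int)
  have one: "(\<Sum>s\<in>{0..<p ^ k}. of_bool ([a * s + b = M] (mod p ^ k))) = (1::int)"
    if "\<not> p dvd a" for a b
  proof -
    have "coprime a (p ^ k)"
      using that assms by (metis coprime_commute coprime_power_right_iff prime_imp_coprime)
    from sum_of_bool_cong[OF pos this, where t = 1 and b = b and c = M] show ?thesis by simp
  qed
  show "(\<Sum>w\<in>{0..<p ^ k}. of_bool ([x * w - y * z = M] (mod p ^ k))) = (1::int)" if "\<not> p dvd x"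
    using one[of x "- (y * z)"] that by simp
  show "(\<Sum>x\<in>{0..<p ^ k}. of_bool ([x * w - y * z = M] (mod p ^ k))) = (1::int)" if "\<not> p dvd w"
    using one[of w "- (y * z)"] that by (simp add: mult.commute)
  show "(\<Sum>z\<in>{0..<p ^ k}. of_bool ([x * w - y * z = M] (mod p ^ k))) = (1::int)" if "\<not> p dvd y"
    using one[of "- y" "x * w"] that by simp
qed

text \<open>Opposite a unit of the first row, the entry of the second row is determined by the
  remaining one, which is free.\<close>

lemma row_count:
  fixes p x y M :: int
  assumes "prime p" and "\<not> (p dvd x \<and> p dvd y)"
  shows "(\<Sum>z\<in>{0..<p ^ k}. \<Sum>w\<in>{0..<p ^ k}. of_bool ([x * w - y * z = M] (mod p ^ k))) = p ^ k"
proof -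
  have pos: "p ^ k > 0" using assms(1) by (simp add: prime_gt_0_int)
  show ?thesis
  proof (cases "p dvd x")
    case True
    then have "\<not> p dvd y" using assms(2) by simp
    then show ?thesis
      \<comment> \<open>Here \<open>z\<close> is the determined entry, so its sum has to be the
        inner one.\<close>
      by (subst sum.swap) (use pos in \<open>simp add: det_solve(3)[OF assms(1)]\<close>)
  next
    case False
    then show ?thesis using pos by (simp add: det_solve(1)[OF assms(1)])
  qed
qed

lemma cong_cmult_div:
  fixes p :: int
  assumes "p > 0"
  shows "[p * a = M] (mod p * m) \<longleftrightarrow> p dvd M \<and> [a = M div p] (mod m)"
proof (cases "p dvd M")
  case True
  then obtain c where "M = p * c" by auto
  then show ?thesis using assms by (simp add: cong_iff_dvd_diff right_diff_distrib[symmetric])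
next
  case False
  have "\<not> [p * a = M] (mod p * m)"
    using False by (metis cong_dvd_iff cong_dvd_modulus dvd_triv_left)
  then show ?thesis using False by simp
qed

text \<open>With \<open>q = p ^ Suc k\<close> there are \<open>q ^ 2 - p ^ (2 * k)\<close> first
  rows containing a unit, each with \<open>q\<close> second rows. The other first rows are
  \<open>p\<close> times a row modulo \<open>p ^ k\<close>, and cancelling \<open>p\<close> leaves a
  determinant condition modulo \<open>p ^ k\<close>.\<close>

lemma det_count_Suc:
  fixes p :: int
  assumes "prime p"
  shows "det_count (p ^ Suc k) (p ^ Suc k) M
    = p ^ (3 * k + 1) * (p ^ 2 - 1) + of_bool (p dvd M) * p ^ 2 * det_count (p ^ k) (p ^ k) (M div p)"
proof -
  have p0: "p > 0" using assms by (simp add: prime_gt_0_int)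
  define q where "q = p ^ Suc k"
  have q: "q = p * p ^ k" by (simp add: q_def)
  obtain P where P: "p = int P" using p0 by (metis nonneg_int_cases less_imp_le)
  have q': "q = p ^ k * int P" by (simp add: q P)
  define G where "G x y = (\<Sum>z\<in>{0..<q}. \<Sum>w\<in>{0..<q}. of_bool ([x * w - y * z = M] (mod q)) :: int)" for x y
  \<comment> \<open>The generic value \<open>q\<close> plus a correction supported on rows divisible
    by \<open>p\<close>; in this form \<open>sum_multiples\<close> applies to the
    correction.\<close>
  have G: "G x y = q + of_bool (p dvd x) * (of_bool (p dvd y) * (G x y - q))" for x y
    using row_count[OF assms, where x = x and y = y and k = "Suc k" and M = M] by (auto simp: G_def q_def)
  have "det_count q q M = (\<Sum>x\<in>{0..<q}. \<Sum>y\<in>{0..<q}. G x y)"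
    by (simp add: det_count_def quad_sum_def G_def)
  also have "\<dots> = (\<Sum>x\<in>{0..<q}. \<Sum>y\<in>{0..<q}. q)
      + (\<Sum>x\<in>{0..<q}. \<Sum>y\<in>{0..<q}. of_bool (p dvd x) * (of_bool (p dvd y) * (G x y - q)))"
    by (subst G) (simp only: sum.distrib)
  also have "(\<Sum>x\<in>{0..<q}. \<Sum>y\<in>{0..<q}. of_bool (p dvd x) * (of_bool (p dvd y) * (G x y - q)))
     = (\<Sum>x\<in>{0..<p ^ k}. \<Sum>y\<in>{0..<p ^ k}. G (p * x) (p * y) - q)"
    unfolding q sum_distrib_left[symmetric] sum_multiples[OF p0] ..
  also have "\<dots> = (\<Sum>x\<in>{0..<p ^ k}. \<Sum>y\<in>{0..<p ^ k}. G (p * x) (p * y)) - p ^ k * (p ^ k * q)"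
    using p0 by (simp add: sum_subtractf)
  also have "(\<Sum>x\<in>{0..<q}. \<Sum>y\<in>{0..<q}. q) = q * (q * q)"
    using p0 by (simp add: q_def)
  also have "(\<Sum>x\<in>{0..<p ^ k}. \<Sum>y\<in>{0..<p ^ k}. G (p * x) (p * y))
      = of_bool (p dvd M) * p ^ 2 * det_count (p ^ k) (p ^ k) (M div p)"
  proof -
    have "[p * x * w - p * y * z = M] (mod q) \<longleftrightarrow> p dvd M \<and> [x * w - y * z = M div p] (mod p ^ k)"
      for x y z w
      using cong_cmult_div[OF p0, of "x * w - y * z" M "p ^ k"]
      by (simp add: q right_diff_distrib mult.assoc)
    then have G1: "G (p * x) (p * y) = of_bool (p dvd M) *
        (\<Sum>z\<in>{0..<q}. \<Sum>w\<in>{0..<q}. of_bool ([x * w - y * z = M div p] (mod p ^ k)))" for x y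
      by (simp add: G_def of_bool_conj sum_distrib_left)
    \<comment> \<open>The second row still ranges modulo \<open>q\<close>, that is, over
      \<open>p\<close> periods of length \<open>p ^ k\<close> in each of its two entries.\<close>
    have G2: "(\<Sum>z\<in>{0..<q}. \<Sum>w\<in>{0..<q}. of_bool ([x * w - y * z = M div p] (mod p ^ k)))
      = p ^ 2 * (\<Sum>z\<in>{0..<p ^ k}. \<Sum>w\<in>{0..<p ^ k}. of_bool ([x * w - y * z = M div p] (mod p ^ k)) :: int)"
      for x y
      unfolding q' using p0
      by (simp add: sum_periodic det_cong_mod sum_distrib_left[symmetric] power2_eq_square) (simp add: P)
    show ?thesis
      unfolding G1 G2 by (simp add: det_count_def quad_sum_def sum_distrib_left mult.assoc)
  qed
  finally show ?thesis
    by (simp add: q_def power_mult algebra_simps power2_eq_square power3_eq_cube power_mult_distrib)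
qed

text \<open>Each recursion step removes one factor \<open>p\<close> from \<open>M\<close>. Since the
  multiplicity is below \<open>k\<close>, the exponent is still positive when \<open>p\<close> no
  longer divides \<open>M\<close>, and there the recursive term vanishes. The contributions form a
  geometric sum; the power of \<open>p\<close> on the left avoids subtraction in exponents.\<close>

lemma det_count_eq:
  fixes p :: int
  assumes "prime p" and "multiplicity p M < k" and "M \<noteq> 0"
  shows "p ^ (multiplicity p M + 2) * det_count (p ^ k) (p ^ k) M
    = p ^ (3 * k) * (p + 1) * (p ^ (multiplicity p M + 1) - 1)"
  using assms(2,3)
proof (induction k arbitrary: M)
  case 0
  then show ?case by simp
next
  case (Suc k)
  show ?case
  proof (cases "p dvd M")
    case False
    then have "multiplicity p M = 0" by (simp add: not_dvd_imp_multiplicity_0)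
    then show ?thesis
      using False by (simp only: det_count_Suc[OF assms(1)]) 
        (simp add: algebra_simps power2_eq_square power_add eval_nat_numeral)
  next
    case True
    then obtain c where c: "M = p * c" by auto
    have p0: "p > 0" using assms(1) by (simp add: prime_gt_0_int)
    have c0: "c \<noteq> 0" using c Suc.prems by auto
    define s where "s = multiplicity p c"
    have s: "multiplicity p M = Suc s"
      using c c0 assms(1) p0 by (simp add: s_def prime_elem_multiplicity_mult_distrib)
    have IH: "p ^ (s + 2) * det_count (p ^ k) (p ^ k) c = p ^ (3 * k) * (p + 1) * (p ^ (s + 1) - 1)"
      using Suc.IH[of c] Suc.prems c0 s by (simp add: s_def)
    have "p ^ (Suc s + 2) * det_count (p ^ Suc k) (p ^ Suc k) M
      = p ^ (Suc s + 2) * p ^ (3 * k + 1) * (p ^ 2 - 1) + p ^ 3 * (p ^ (s + 2) * det_count (p ^ k) (p ^ k) c)"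
      using p0 by (simp only: det_count_Suc[OF assms(1)]) (simp add: c algebra_simps power2_eq_square power3_eq_cube)
    also have "\<dots> = p ^ (3 * Suc k) * (p + 1) * (p ^ (Suc s + 1) - 1)"
      unfolding IH by (simp add: algebra_simps power2_eq_square power3_eq_cube power_add)
    finally show ?thesis by (simp only: s)
  qed
qed

section \<open>Imposing invertibility and divisibility conditions\<close>

lemma sum_of_bool_dvd:
  fixes p r c :: int
  assumes "p > 0" and "r \<ge> 0"
  shows "(\<Sum>x\<in>{0..<p * r}. of_bool (p dvd x + c)) = r"
proof -
  obtain t where "r = int t" using assms(2) nonneg_int_cases by blast
  then show ?thesis
    using sum_of_bool_cong[OF assms(1), where a = 1 and t = t and b = c and c = 0]
    by (simp add: cong_0_iff)
qed

lemma quad_sum_add: "quad_sum m (\<lambda>x y z w. f x y z w + g x y z w) = quad_sum m f + quad_sum m g"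
  by (simp add: quad_sum_def sum.distrib)

lemma quad_sum_diff: "quad_sum m (\<lambda>x y z w. f x y z w - g x y z w) = quad_sum m f - quad_sum m g"
  by (simp add: quad_sum_def sum_subtractf)

lemma quad_sum_cmult: "quad_sum m (\<lambda>x y z w. c * f x y z w) = c * quad_sum m f"
  by (simp add: quad_sum_def sum_distrib_left)

text \<open>The determinant is symmetric in its diagonal entries, so a count with a condition on
  \<open>x\<close> carries over to \<open>w\<close>.\<close>

lemma quad_sum_swap: "quad_sum m (\<lambda>x y z w. f w y z x) = quad_sum m f"
  unfolding quad_sum_def sum.cartesian_product
  by (rule sum.reindex_bij_witness[of _ "\<lambda>(x, y, z, w). (w, y, z, x)" "\<lambda>(x, y, z, w). (w, y, z, x)"])
    auto

text \<open>Modulo \<open>p\<close> the determinant of \<open>B + 1\<close> is \<open>det B + 1 + tr B\<close>, and it factors as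
  \<open>(x + 1) * (w + 1)\<close> once \<open>p\<close> divides \<open>y\<close>.\<close>

lemma singular_count:
  fixes p N :: int
  assumes "prime p"
  shows "quad_sum (p ^ Suc k)
      (\<lambda>x y z w. of_bool ([x * w - y * z = N] (mod p ^ Suc k) \<and> p dvd N + 1 + x + w))
    = p ^ (3 * k + 1) * (p + of_bool (\<not> p dvd N - 1))"
proof -
  have p0: "p > 0" using assms by (simp add: prime_gt_0_int)
  define q r s where "q = p ^ Suc k" and "r = p ^ k" and "s = (of_bool (\<not> p dvd N - 1) :: int)"
  have q: "q = p * r" and r0: "r \<ge> 0" and q0: "q \<ge> 0"
    using p0 by (simp_all add: q_def r_def)
  let ?P = "\<lambda>x y z w. [x * w - y * z = N] (mod q)"
  note solve = det_solve[OF assms, where k = "Suc k" and M = N, folded q_def]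
  note dvd_count = sum_of_bool_dvd[OF p0 r0, folded q]
  have dvd_count0: "(\<Sum>x\<in>{0..<q}. of_bool (p dvd x)) = r"
    using dvd_count[of 0] by simp
  have ndvd_count: "(\<Sum>x\<in>{0..<q}. of_bool (\<not> p dvd x)) = q - r"
    using dvd_count0 q0 by (simp add: of_bool_not_iff sum_subtractf)
  \<comment> \<open>Inclusion-exclusion when \<open>p\<close> divides \<open>y\<close>: the
    conditions \<open>p dvd x + 1\<close> and \<open>p dvd w + 1\<close> coincide if
    \<open>N\<close> is 1 modulo \<open>p\<close> and exclude each other otherwise, because
    \<open>x * w\<close> is \<open>N\<close> modulo \<open>p\<close>. The factor \<open>s\<close>
    therefore counts the second condition only in the latter case.\<close>
  have pointwise: "of_bool (?P x y z w \<and> p dvd N + 1 + x + w)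
    = of_bool (\<not> p dvd y) * of_bool (p dvd N + 1 + x + w) * of_bool (?P x y z w)
      + of_bool (p dvd x + 1) * of_bool (p dvd y) * of_bool (?P x y z w)
      + s * (of_bool (p dvd w + 1) * of_bool (p dvd y) * of_bool (?P x y z w))" for x y z w
  proof (cases "p dvd y \<and> ?P x y z w")
    case True
    then have "p dvd x * w - y * z - N"
      unfolding q by (metis cong_iff_dvd_diff dvd_mult_left)
    moreover have "x * w - N = (x * w - y * z - N) + y * z" by simp
    ultimately have xw: "p dvd x * w - N" using True by (metis dvd_add dvd_mult2)
    have "(x + 1) * (w + 1) = (N + 1 + x + w) + (x * w - N)" by (simp add: algebra_simps)
    then have fac: "p dvd N + 1 + x + w \<longleftrightarrow> p dvd x + 1 \<or> p dvd w + 1"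
      using xw prime_dvd_mult_iff[OF assms] by (metis dvd_add_left_iff)
    have "p dvd w + 1 \<longleftrightarrow> p dvd N - 1" if "p dvd x + 1"
    proof -
      have "w + 1 + (N - 1) = (x + 1) * w - (x * w - N)" by (simp add: algebra_simps)
      then have "p dvd w + 1 + (N - 1)" using that xw by (metis dvd_diff dvd_mult2)
      then show ?thesis by (metis dvd_add_right_iff dvd_add_left_iff)
    qed
    moreover have "p dvd x + 1 \<longleftrightarrow> p dvd N - 1" if "p dvd w + 1"
    proof -
      have "x + 1 + (N - 1) = (w + 1) * x - (x * w - N)" by (simp add: algebra_simps)
      then have "p dvd x + 1 + (N - 1)" using that xw by (metis dvd_diff dvd_mult2)
      then show ?thesis by (metis dvd_add_right_iff dvd_add_left_iff)
    qed
    ultimately show ?thesis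
      using True unfolding s_def fac
      by (cases "p dvd x + 1"; cases "p dvd w + 1") auto
  qed auto
  \<comment> \<open>Free \<open>x\<close>, a unit \<open>y\<close>, then \<open>w\<close> in a fixed
    class modulo \<open>p\<close>; the unit \<open>y\<close> determines \<open>z\<close>.\<close>
  have 1: "quad_sum q (\<lambda>x y z w. of_bool (\<not> p dvd y) * of_bool (p dvd N + 1 + x + w) * of_bool (?P x y z w))
    = q * ((q - r) * r)"
  proof -
    have "(\<Sum>z\<in>{0..<q}. \<Sum>w\<in>{0..<q}.
        of_bool (\<not> p dvd y) * of_bool (p dvd N + 1 + x + w) * of_bool (?P x y z w))
      = of_bool (\<not> p dvd y) * r" for x y
    proof -
      have "(\<Sum>z\<in>{0..<q}. \<Sum>w\<in>{0..<q}.
          of_bool (\<not> p dvd y) * of_bool (p dvd N + 1 + x + w) * of_bool (?P x y z w))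
        = of_bool (\<not> p dvd y) * (\<Sum>w\<in>{0..<q}. of_bool (p dvd N + 1 + x + w) *
            (\<Sum>z\<in>{0..<q}. of_bool (?P x y z w)) :: int)"
        by (subst sum.swap) (simp only: sum_distrib_left mult.assoc)
      also have "\<dots> = of_bool (\<not> p dvd y) * r"
        using solve(3) dvd_count[of "N + 1 + x"] by (cases "p dvd y") (simp_all add: add.commute[of _ "N + 1 + x"])
      finally show ?thesis .
    qed
    then show ?thesis
      using q0 by (simp add: quad_sum_def sum_distrib_right[symmetric] ndvd_count del: of_bool_not_iff)
  qed
  \<comment> \<open>Here \<open>x\<close> is -1 modulo \<open>p\<close>, hence a unit that
    determines \<open>w\<close>; \<open>y\<close> is a multiple of \<open>p\<close> and
    \<open>z\<close> is free.\<close>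
  have 2: "quad_sum q (\<lambda>x y z w. of_bool (p dvd x + 1) * of_bool (p dvd y) * of_bool (?P x y z w))
    = r * r * q"
  proof -
    have w: "(\<Sum>w\<in>{0..<q}. of_bool (p dvd x + 1) * of_bool (p dvd y) * of_bool (?P x y z w))
      = (of_bool (p dvd x + 1) * of_bool (p dvd y) :: int)" for x y z
    proof (cases "p dvd x + 1")
      case True
      then have "\<not> p dvd x" using assms by (metis dvd_add_right_iff not_prime_unit)
      from solve(1)[OF this] show ?thesis by (simp add: sum_distrib_left[symmetric])
    qed simp
    show ?thesis
      unfolding quad_sum_def w using q0 dvd_count[of 1]
      by (simp add: sum_distrib_left[symmetric] sum_distrib_right[symmetric] dvd_count0 mult.assoc)
  qed
  have 3: "quad_sum q (\<lambda>x y z w. of_bool (p dvd w + 1) * of_bool (p dvd y) * of_bool (?P x y z w))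
    = r * r * q"
    using 2 quad_sum_swap[of q "\<lambda>x y z w. of_bool (p dvd x + 1) * of_bool (p dvd y) * of_bool (?P x y z w)"]
    by (simp add: mult.commute)
  have "quad_sum q (\<lambda>x y z w. of_bool (?P x y z w \<and> p dvd N + 1 + x + w))
    = q * ((q - r) * r) + r * r * q + s * (r * r * q)"
    unfolding pointwise quad_sum_add quad_sum_cmult 1 2 3 ..
  also have "\<dots> = p ^ (3 * k + 1) * (p + s)"
    by (simp add: q r_def algebra_simps power_add power_mult power3_eq_cube power_mult_distrib)
  finally show ?thesis by (simp only: q_def s_def)
qed

text \<open>Complementary count: among matrices of determinant \<open>N\<close>, those with
  \<open>1 + B\<close> singular modulo \<open>p\<close> are the ones of
  \<open>singular_count\<close>.\<close>

lemma count_unramified: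
  fixes p N :: int
  assumes "prime p"
  shows "quad_sum (p ^ Suc k)
      (\<lambda>x y z w. of_bool ([x * w - y * z = N] (mod p ^ Suc k) \<and> \<not> p dvd (x + 1) * (w + 1) - y * z))
    = det_count (p ^ Suc k) (p ^ Suc k) N - p ^ (3 * k + 1) * (p + of_bool (\<not> p dvd N - 1))"
proof -
  have "p dvd (x + 1) * (w + 1) - y * z \<longleftrightarrow> p dvd N + 1 + x + w"
    if "[x * w - y * z = N] (mod p ^ Suc k)" for x y z w
  proof -
    have "p dvd x * w - y * z - N"
      using that by (metis cong_iff_dvd_diff dvd_mult_left power_Suc)
    moreover have "(x + 1) * (w + 1) - y * z = (N + 1 + x + w) + (x * w - y * z - N)"
      by (simp add: algebra_simps)
    ultimately show ?thesis by (metis dvd_add_left_iff)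
  qed
  then have "of_bool ([x * w - y * z = N] (mod p ^ Suc k) \<and> \<not> p dvd (x + 1) * (w + 1) - y * z)
    = of_bool ([x * w - y * z = N] (mod p ^ Suc k))
      - (of_bool ([x * w - y * z = N] (mod p ^ Suc k) \<and> p dvd N + 1 + x + w) :: int)" for x y z w
    by (auto simp del: power_Suc)
  then show ?thesis
    by (simp only: quad_sum_diff singular_count[OF assms] det_count_def)
qed

text \<open>Writing \<open>B\<close> as \<open>p ^ u\<close> times \<open>B'\<close> divides the
  determinant by \<open>p ^ (2 * u)\<close>, so the condition on \<open>B'\<close> is modulo
  \<open>p ^ (e - 2 * u)\<close>. The entries of \<open>B'\<close> range modulo
  \<open>p ^ (e - u)\<close>, which is \<open>p ^ u\<close> periods for each of the four.\<close>

lemma count_ramified: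
  fixes p N :: int
  assumes "prime p" and "2 * u \<le> e"
  shows "quad_sum (p ^ e) (\<lambda>x y z w. of_bool ([x * w - y * z = p ^ (2 * u) * N] (mod p ^ e) \<and>
        p ^ u dvd x \<and> p ^ u dvd y \<and> p ^ u dvd z \<and> p ^ u dvd w))
    = p ^ (4 * u) * det_count (p ^ (e - 2 * u)) (p ^ (e - 2 * u)) N"
proof -
  have p0: "p > 0" using assms(1) by (simp add: prime_gt_0_int)
  obtain P where P: "p = int P" using p0 by (metis nonneg_int_cases less_imp_le)
  obtain j where e: "e = 2 * u + j" using assms(2) le_Suc_ex by blast
  have scale: "[p ^ u * x * (p ^ u * w) - p ^ u * y * (p ^ u * z) = p ^ (2 * u) * N] (mod p ^ e)
      \<longleftrightarrow> [x * w - y * z = N] (mod p ^ j)" for x y z w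
    using cong_cmult_div[of "p ^ (2 * u)" "x * w - y * z" "p ^ (2 * u) * N" "p ^ j"] p0
    by (simp add: e power_add power_mult algebra_simps power2_eq_square power_mult_distrib)
  have pe: "p ^ e = p ^ u * p ^ (u + j)" by (simp add: e power_add mult_2)
  have "p ^ u > 0" using p0 by simp
  from quad_sum_multiples[OF this, of "p ^ (u + j)" "\<lambda>x y z w. of_bool ([x * w - y * z = p ^ (2 * u) * N] (mod p ^ e))"]
  have "quad_sum (p ^ e) (\<lambda>x y z w. of_bool (p ^ u dvd x \<and> p ^ u dvd y \<and> p ^ u dvd z \<and> p ^ u dvd w) *
        of_bool ([x * w - y * z = p ^ (2 * u) * N] (mod p ^ e)))
    = det_count (p ^ (u + j)) (p ^ j) N"
    by (simp only: pe[symmetric] scale det_count_def)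
  also have "p ^ (u + j) = p ^ j * int (P ^ u)" by (simp add: P power_add)
  also have "det_count \<dots> (p ^ j) N = p ^ (4 * u) * det_count (p ^ j) (p ^ j) N"
    using det_count_periodic[of "p ^ j" "P ^ u" N] p0 by (simp add: P power_mult[symmetric] mult.commute)
  finally show ?thesis by (simp add: of_bool_conj[symmetric] conj_commute e flip: of_bool_conj)
qed

section \<open>Matrices as quadruples, and the order of the general linear group\<close>

lemma card_mat2:
  "int (card {A :: int^2^2. (\<forall>i j. A $ i $ j \<in> {0..<q}) \<and> Q (A $ 1 $ 1) (A $ 1 $ 2) (A $ 2 $ 1) (A $ 2 $ 2)})
    = quad_sum q (\<lambda>x y z w. of_bool (Q x y z w))" (is "int (card ?M) = _")
proof -
  let ?S = "{0..<q}"
  let ?T = "{t \<in> ?S \<times> ?S \<times> ?S \<times> ?S. case t of (x, y, z, w) \<Rightarrow> Q x y z w}"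
  have 1: "card ?M = card ?T"
  proof (rule bij_betw_same_card)
    show "bij_betw (\<lambda>A. (A $ 1 $ 1, A $ 1 $ 2, A $ 2 $ 1, A $ 2 $ 2)) ?M ?T"
      by (rule bij_betw_byWitness[where f' = "\<lambda>(x, y, z, w). vector [vector [x, y], vector [z, w]]"])
        (auto simp: vec_eq_iff forall_2)
  qed
  have 2: "int (card ?T) = (\<Sum>t\<in>?S \<times> ?S \<times> ?S \<times> ?S. of_bool (case t of (x, y, z, w) \<Rightarrow> Q x y z w))"
    by (simp add: sum_of_bool_eq Int_def)
  have 3: "(\<Sum>t\<in>?S \<times> ?S \<times> ?S \<times> ?S. of_bool (case t of (x, y, z, w) \<Rightarrow> Q x y z w))
      = quad_sum q (\<lambda>x y z w. of_bool (Q x y z w))"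
    by (simp add: quad_sum_def sum.cartesian_product case_prod_unfold)
  show ?thesis by (simp only: 1 2 3)
qed

text \<open>Multiplicativity of the determinant makes it a unit for invertible matrices; conversely
  the adjugate, scaled by an inverse of the determinant, is an inverse matrix.\<close>

lemma carrier_GL2_mod:
  assumes "q > 0"
  shows "carrier (GL2_mod q) = {A. (\<forall>i j. A $ i $ j \<in> {0..<q}) \<and> coprime (det A) q}"
proof -
  have car: "carrier (mat2_mod q) = {A. \<forall>i j. A $ i $ j \<in> {0..<q}}"
    by (auto simp: mat2_mod_def residue_ring_def)
  have red: "reduce_mat q A = reduce_mat q B \<longleftrightarrow> (\<forall>i j. [A $ i $ j = B $ i $ j] (mod q))" for A B
    by (simp add: reduce_mat_def vec_eq_iff cong_def)
  have fwd: "coprime (det A) q" if "reduce_mat q (A ** B) = reduce_mat q (mat 1)" for A B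
  proof -
    have "[det (A ** B) = det (mat 1 :: int^2^2)] (mod q)"
      using that unfolding red det_2[of "A ** B"] det_2[of "mat 1"] by (intro cong_diff cong_mult) blast+
    then have "[det A * det B = 1] (mod q)" by (simp add: det_mul)
    then show ?thesis by (subst coprime_iff_invertible_int) (rule exI)
  qed
  have bwd: "\<exists>B\<in>carrier (mat2_mod q). reduce_mat q (A ** B) = reduce_mat q (mat 1) \<and>
      reduce_mat q (B ** A) = reduce_mat q (mat 1)" if cop: "coprime (det A) q" for A
  proof -
    obtain k where k: "[det A * k = 1] (mod q)" using cong_solve_coprime_int[OF cop] by auto
    \<comment> \<open>The adjugate of \<open>A\<close> times \<open>k\<close>, the inverse of
      \<open>det A\<close> modulo \<open>q\<close>.\<close>
    define B :: "int^2^2" where "B = vector [vector [k * A $ 2 $ 2, - k * A $ 1 $ 2], vector [- k * A $ 2 $ 1, k * A $ 1 $ 1]]"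
    have AB: "A ** B = mat (det A * k)" "B ** A = mat (det A * k)"
      by (simp_all add: B_def matrix_matrix_mult_def vec_eq_iff forall_2 sum_2 mat_def det_2 algebra_simps)
    have "reduce_mat q (A ** reduce_mat q B) = reduce_mat q (A ** B)"
      "reduce_mat q (reduce_mat q B ** A) = reduce_mat q (B ** A)"
      unfolding red by (auto simp: reduce_mat_def matrix_matrix_mult_def sum_2 intro!: cong_add cong_mult)
    moreover have "reduce_mat q (mat (det A * k)) = reduce_mat q (mat 1 :: int^2^2)"
      using k unfolding red by (auto simp: mat_def)
    moreover have "reduce_mat q B \<in> carrier (mat2_mod q)"
      using assms by (simp add: car reduce_mat_def)
    ultimately show ?thesis unfolding AB[symmetric] by (metis AB)
  qed
  have "carrier (GL2_mod q) = Units (mat2_mod q)" by (simp add: GL2_mod_def units_of_def)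
  also have "\<dots> = {A \<in> carrier (mat2_mod q). coprime (det A) q}"
  proof -
    have "A \<in> Units (mat2_mod q) \<longleftrightarrow> A \<in> carrier (mat2_mod q) \<and> (\<exists>B\<in>carrier (mat2_mod q).
        reduce_mat q (B ** A) = reduce_mat q (mat 1) \<and> reduce_mat q (A ** B) = reduce_mat q (mat 1))" for A
      by (simp add: Units_def mat2_mod_def)
    then show ?thesis using fwd bwd by blast
  qed
  finally show ?thesis by (simp add: car)
qed

text \<open>Invertibility depends only on the determinant modulo \<open>p\<close>. The singular
  matrices number \<open>det_count q p 0\<close>, which periodicity reduces to modulus
  \<open>p\<close>, where one recursion step from the trivial modulus evaluates it.\<close>

lemma order_GL2_mod:
  assumes "prime l"
  shows "int (order (GL2_mod (int l ^ Suc k))) = int l ^ (4 * k + 1) * (int l - 1) ^ 2 * (int l + 1)"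
proof -
  define p where "p = int l"
  have pr: "prime p" using assms by (simp add: p_def)
  have p0: "p > 0" using pr by (simp add: prime_gt_0_int)
  define q where "q = p ^ Suc k"
  have q0: "q > 0" using p0 by (simp add: q_def)
  have "coprime d q \<longleftrightarrow> \<not> p dvd d" for d
    using pr unfolding q_def coprime_power_right_iff
    by (metis coprime_absorb_right coprime_commute nat.distinct(1) not_prime_unit prime_imp_coprime)
  then have "carrier (GL2_mod q) = {A. (\<forall>i j. A $ i $ j \<in> {0..<q}) \<and>
      \<not> [A $ 1 $ 1 * A $ 2 $ 2 - A $ 1 $ 2 * A $ 2 $ 1 = 0] (mod p)}"
    by (simp add: carrier_GL2_mod[OF q0] det_2 cong_0_iff)
  then have "int (order (GL2_mod q))
    = quad_sum q (\<lambda>x y z w. of_bool (\<not> [x * w - y * z = 0] (mod p)))"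
    using card_mat2[of q "\<lambda>x y z w. \<not> [x * w - y * z = 0] (mod p)"] by (simp only: order_def)
  also have "\<dots> = quad_sum q (\<lambda>x y z w. 1 - of_bool ([x * w - y * z = 0] (mod p)))"
    by (rule quad_sum_cong) simp
  also have "\<dots> = quad_sum q (\<lambda>x y z w. 1) - det_count q p 0"
    by (simp only: quad_sum_diff det_count_def)
  also have "quad_sum q (\<lambda>x y z w. 1) = q ^ 4"
    using q0 by (simp add: quad_sum_def power4_eq_xxxx)
  also have "det_count q p 0 = (p ^ k) ^ 4 * det_count p p 0"
    using det_count_periodic[OF p0, of "l ^ k" 0] by (simp add: q_def p_def)
  also have "det_count p p 0 = p ^ 3 + p ^ 2 - p"
    using det_count_Suc[OF pr, of 0 0]
    by (simp add: det_count_def quad_sum_def power3_eq_cube power2_eq_square algebra_simps)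
  finally show ?thesis
    by (simp add: p_def q_def algebra_simps power2_eq_square power3_eq_cube power4_eq_xxxx power_add power_mult_distrib eval_nat_numeral)
qed

section \<open>The cardinality of \<open>C_set\<close> in scaled form\<close>

lemma multiplicity_int: "multiplicity (int a) (int b) = multiplicity a b"
  unfolding multiplicity_def by (simp flip: of_nat_power)

text \<open>This passes from \<open>A\<close> to \<open>B = A - 1\<close>. The bound on
  \<open>u\<close> makes \<open>p ^ u\<close> divide the modulus, so that the congruence to the
  identity depends only on residues.\<close>

lemma card_C_set:
  fixes l n N k :: nat
  defines "p \<equiv> int l" and "u \<equiv> multiplicity l n"
  assumes "prime l" and u: "u \<le> Suc k"
  shows "int (card (C_set N n l (Suc k)))
    = quad_sum (p ^ Suc k) (\<lambda>x y z w. of_bool (([x * w - y * z = int N] (mod p ^ Suc k) \<and>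
        \<not> p dvd (x + 1) * (w + 1) - y * z) \<and> p ^ u dvd x \<and> p ^ u dvd y \<and> p ^ u dvd z \<and> p ^ u dvd w))"
proof -
  have pr: "prime p" using assms by (simp add: p_def)
  define q where "q = p ^ Suc k"
  have q0: "q > 0" using pr by (simp add: q_def prime_gt_0_int)
  have pq: "p dvd q" and uq: "p ^ u dvd q"
    using le_imp_power_dvd[OF u, of p] by (simp_all add: q_def)
  define Q where "Q a b c d \<longleftrightarrow> [a * d - b * c + 1 - (a + d) = int N] (mod q) \<and>
    \<not> p dvd a * d - b * c \<and> p ^ u dvd a - 1 \<and> p ^ u dvd b \<and> p ^ u dvd c \<and> p ^ u dvd d - 1" for a b c d
  have cop: "coprime d q \<longleftrightarrow> \<not> p dvd d" for d
    using pr unfolding q_def coprime_power_right_iff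
    by (metis coprime_absorb_right coprime_commute nat.distinct(1) not_prime_unit prime_imp_coprime)
  \<comment> \<open>Adding 1 to a diagonal entry can leave the range of representatives, so the
    shift requires that \<open>Q\<close> depend only on residues.\<close>
  have per: "Q a b c d \<longleftrightarrow> Q a' b c d'" if a: "[a = a'] (mod q)" and d: "[d = d'] (mod q)" for a a' b c d d'
  proof -
    have "[a * d - b * c = a' * d' - b * c] (mod q)"
      using a d by (intro cong_diff cong_mult cong_refl)
    moreover from this have "p dvd a * d - b * c \<longleftrightarrow> p dvd a' * d' - b * c"
      using pq cong_dvd_modulus cong_dvd_iff by metis
    moreover have "[a * d - b * c + 1 - (a + d) = int N] (mod q) \<longleftrightarrow>
        [a' * d' - b * c + 1 - (a' + d') = int N] (mod q)"
      using a d by (intro cong_cong_lhs cong_diff cong_add cong_mult cong_refl)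
    moreover have "p ^ u dvd a - 1 \<longleftrightarrow> p ^ u dvd a' - 1" "p ^ u dvd d - 1 \<longleftrightarrow> p ^ u dvd d' - 1"
      using a d by (auto intro!: cong_dvd_iff cong_dvd_modulus[OF _ uq] cong_diff)
    ultimately show ?thesis unfolding Q_def by blast
  qed
  have "C_set N n l (Suc k)
    = {A. (\<forall>i j. A $ i $ j \<in> {0..<q}) \<and> Q (A $ 1 $ 1) (A $ 1 $ 2) (A $ 2 $ 1) (A $ 2 $ 2)}"
    unfolding C_set_def p_def[symmetric] q_def[symmetric] u_def[symmetric] carrier_GL2_mod[OF q0] cop
    by (auto simp: Q_def det_2 trace_def sum_2 forall_2 mat_def cong_iff_dvd_diff)
  then have "int (card (C_set N n l (Suc k))) = quad_sum q (\<lambda>x y z w. of_bool (Q x y z w))"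
    using card_mat2[of q Q] by (simp only:)
  also have "\<dots> = quad_sum q (\<lambda>x y z w. of_bool (Q (x + 1) y z (w + 1)))"
    by (rule quad_sum_shift[OF q0, symmetric]) (rule arg_cong[where f = of_bool], rule per; simp)+
  also have "\<dots> = quad_sum q (\<lambda>x y z w. of_bool (([x * w - y * z = int N] (mod q) \<and>
        \<not> p dvd (x + 1) * (w + 1) - y * z) \<and> p ^ u dvd x \<and> p ^ u dvd y \<and> p ^ u dvd z \<and> p ^ u dvd w))"
  proof (rule quad_sum_cong)
    fix x y z w :: int
    have eq: "(x + 1) * (w + 1) - y * z + 1 - (x + 1 + (w + 1)) = x * w - y * z"
      by (simp add: algebra_simps)
    show "of_bool (Q (x + 1) y z (w + 1)) = (of_bool (([x * w - y * z = int N] (mod q) \<and>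
        \<not> p dvd (x + 1) * (w + 1) - y * z) \<and> p ^ u dvd x \<and> p ^ u dvd y \<and> p ^ u dvd z \<and> p ^ u dvd w) :: int)"
      unfolding Q_def by (simp only: eq add_diff_cancel_right' conj_assoc)
  qed
  finally show ?thesis by (simp only: q_def)
qed

text \<open>The count by determinant minus the singular translates. The formula covers
  \<open>v = 0\<close> and \<open>v \<ge> 1\<close> together; the symbol is evaluated later.\<close>

lemma card_C_set_unramified:
  fixes l n N k :: nat
  defines "v \<equiv> multiplicity l N"
  assumes l: "prime l" and N: "N > 0" and "multiplicity l n = 0" and v: "v \<le> k"
  shows "int l ^ (v + 2) * int (card (C_set N n l (Suc k)))
    = int l ^ (3 * k + 3) * ((int l + 1) * (int l ^ (v + 1) - 1)
        - int l ^ v * (int l + symbol_sq (int N - 1) l))"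
proof -
  define p where "p = int l"
  have pr: "prime p" using l by (simp add: p_def)
  have v': "multiplicity p (int N) = v" by (simp add: p_def v_def multiplicity_int)
  have "int (card (C_set N n l (Suc k)))
    = det_count (p ^ Suc k) (p ^ Suc k) (int N) - p ^ (3 * k + 1) * (p + of_bool (\<not> p dvd int N - 1))"
    using card_C_set[OF l, of n k N] count_unramified[OF pr, of k "int N"] assms(4) by (simp add: p_def del: power_Suc)
  moreover have "of_bool (\<not> p dvd int N - 1) = symbol_sq (int N - 1) l"
    by (simp add: symbol_sq_def p_def)
  moreover have "p ^ (v + 2) * det_count (p ^ Suc k) (p ^ Suc k) (int N)
      = p ^ (3 * Suc k) * (p + 1) * (p ^ (v + 1) - 1)"
    using det_count_eq[OF pr, of "int N" "Suc k"] v N by (simp add: v' del: power_Suc)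
  moreover have "p ^ (v + 2) * p ^ (3 * k + 1) = p ^ (3 * k + 3) * p ^ v"
    by (simp add: power_add power2_eq_square power3_eq_cube)
  ultimately have "p ^ (v + 2) * int (card (C_set N n l (Suc k)))
    = p ^ (3 * Suc k) * (p + 1) * (p ^ (v + 1) - 1) - p ^ (3 * k + 3) * p ^ v * (p + symbol_sq (int N - 1) l)"
    by (simp only: right_diff_distrib mult.assoc[symmetric])
  then show ?thesis by (simp add: p_def algebra_simps)
qed

text \<open>Removing \<open>p ^ u\<close> from \<open>B\<close> leaves the determinant count for
  \<open>M = N / p ^ (2 * u)\<close>, whose multiplicity is \<open>v - 2 * u\<close>.\<close>

lemma card_C_set_ramified:
  fixes l n N k :: nat
  defines "u \<equiv> multiplicity l n" and "v \<equiv> multiplicity l N"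
  assumes l: "prime l" and N: "N > 0" and u: "u \<ge> 1" "2 * u \<le> v" and v: "v \<le> k"
  shows "int l ^ (v + 2) * int (card (C_set N n l (Suc k)))
    = int l ^ (3 * k + 3) * (int l + 1) * (int l ^ (v - 2 * u + 1) - 1)"
proof -
  define p where "p = int l"
  have pr: "prime p" using l by (simp add: p_def)
  have p0: "p \<noteq> 0" using pr by auto
  have v': "multiplicity p (int N) = v" by (simp add: p_def v_def multiplicity_int)
  have "p ^ (2 * u) dvd int N" using u(2) v' by (metis multiplicity_dvd')
  then obtain M where M: "int N = p ^ (2 * u) * M" by auto
  have M0: "M \<noteq> 0" using M N by auto
  have w: "multiplicity p M = v - 2 * u"
    using prime_elem_multiplicity_mult_distrib[of p "p ^ (2 * u)" M] prime_imp_prime_elem[OF pr] p0 M0 v' M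
    by (simp add: multiplicity_same_power)
  obtain w where vw: "v = 2 * u + w" using u(2) le_Suc_ex by blast
  \<comment> \<open>The exponent left after dividing the determinant by \<open>p ^ (2 * u)\<close>;
    \<open>v \<le> k\<close> makes it exceed \<open>w\<close>, as \<open>det_count_eq\<close>
    requires.\<close>
  obtain j where k: "Suc k = 2 * u + j" using u(2) v le_Suc_ex by (metis le_SucI le_trans)
  have "p dvd p ^ u" using u(1) by (simp add: dvd_power)
  \<comment> \<open>The determinant of \<open>1 + B\<close> is 1 modulo \<open>p\<close>.\<close>
  then have auto_unit: "\<not> p dvd (x + 1) * (w + 1) - y * z"
    if "p ^ u dvd x" "p ^ u dvd y" "p ^ u dvd w" for x y z w
  proof -
    have "p dvd x" "p dvd y" "p dvd w" using that \<open>p dvd p ^ u\<close> dvd_trans by blast+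
    then have "p dvd x * w + x + w - y * z" by simp
    moreover have "(x + 1) * (w + 1) - y * z = (x * w + x + w - y * z) + 1" by (simp add: algebra_simps)
    ultimately show ?thesis using pr by (metis dvd_add_right_iff not_prime_unit)
  qed
  have "int (card (C_set N n l (Suc k)))
    = quad_sum (p ^ Suc k) (\<lambda>x y z w. of_bool (([x * w - y * z = int N] (mod p ^ Suc k) \<and>
        \<not> p dvd (x + 1) * (w + 1) - y * z) \<and> p ^ u dvd x \<and> p ^ u dvd y \<and> p ^ u dvd z \<and> p ^ u dvd w))"
    unfolding p_def u_def using u v by (intro card_C_set l) (simp add: u_def)
  also have "\<dots> = quad_sum (p ^ Suc k) (\<lambda>x y z w. of_bool ([x * w - y * z = p ^ (2 * u) * M] (mod p ^ Suc k) \<and>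
        p ^ u dvd x \<and> p ^ u dvd y \<and> p ^ u dvd z \<and> p ^ u dvd w))"
    using auto_unit by (intro quad_sum_cong) (auto simp: M simp del: power_Suc)
  also have "\<dots> = p ^ (4 * u) * det_count (p ^ j) (p ^ j) M"
    using count_ramified[OF pr, of u "Suc k" M] u v by (simp add: k del: power_Suc)
  finally have card: "int (card (C_set N n l (Suc k))) = p ^ (4 * u) * det_count (p ^ j) (p ^ j) M" .
  have "p ^ (w + 2) * det_count (p ^ j) (p ^ j) M = p ^ (3 * j) * (p + 1) * (p ^ (w + 1) - 1)"
    using det_count_eq[OF pr, of M j] M0 w vw v k by simp
  moreover have "p ^ (v + 2) * p ^ (4 * u) = p ^ (6 * u) * p ^ (w + 2)"
    by (simp add: vw flip: power_add)
  ultimately have "p ^ (v + 2) * (p ^ (4 * u) * det_count (p ^ j) (p ^ j) M)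
      = p ^ (6 * u) * (p ^ (3 * j) * (p + 1) * (p ^ (w + 1) - 1))"
    by (metis mult.assoc)
  also have "\<dots> = p ^ (3 * k + 3) * (p + 1) * (p ^ (w + 1) - 1)"
  proof -
    have "3 * k + 3 = 6 * u + 3 * j" using k by simp
    then show ?thesis by (simp add: power_add mult.assoc)
  qed
  finally show ?thesis by (simp add: card vw p_def)
qed

section \<open>Exact counts, densities and the case distinction\<close>

text \<open>The exponents combine as
  \<open>(k + 1) + (3 * k + 3) - (4 * k + 1) - (v + 2) = 1 - v\<close>, so the quotient does not
  depend on \<open>k\<close>.\<close>

lemma density_algebra:
  fixes p C G :: real and k v :: nat
  assumes "p > 1" and "G = p ^ (4 * k + 1) * (p - 1) ^ 2 * (p + 1)"
    and "p ^ (v + 2) * C = p ^ (3 * k + 3) * X"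
  shows "p ^ Suc k * C / G = p * X / (p ^ v * (p - 1) ^ 2 * (p + 1))"
proof -
  have nz: "p \<noteq> 0" "p - 1 \<noteq> 0" "p + 1 \<noteq> 0" using assms(1) by auto
  \<comment> \<open>The extra \<open>p ^ 2\<close> completes \<open>p ^ v\<close> to the
    \<open>p ^ (v + 2)\<close> of the hypothesis on \<open>C\<close>.\<close>
  have "p ^ Suc k * C * (p ^ v * (p - 1) ^ 2 * (p + 1)) * p ^ 2
    = p ^ Suc k * (p ^ (v + 2) * C) * ((p - 1) ^ 2 * (p + 1))"
    by (simp add: power_add power2_eq_square mult_ac)
  also have "\<dots> = p * X * G * p ^ 2"
    unfolding assms(2,3) by (simp add: power_add power_mult power2_eq_square power3_eq_cube eval_nat_numeral mult_ac power_mult_distrib)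
  finally have "p ^ Suc k * C * (p ^ v * (p - 1) ^ 2 * (p + 1)) = p * X * G"
    using nz by (metis mult_right_cancel power_not_zero)
  then show ?thesis using nz by (subst frac_eq_eq) (simp_all add: assms(2) power2_eq_square)
qed

lemma scaled_card_C_set:
  fixes l n N e v :: nat and X :: int
  defines "C \<equiv> card (C_set N n l e)"
  assumes l: "prime l" and e: "e > v"
    and X: "int l ^ (v + 2) * int C = int l ^ (3 * e) * X"
  shows "int C = int l ^ (3 * e - v - 2) * X"
    and "real l ^ e * real C / real (order (GL2_mod (int l ^ e)))
      = real l * real_of_int X / (real l ^ v * (real l - 1) ^ 2 * (real l + 1))"
proof -
  have l2: "l \<ge> 2" using l prime_ge_2_nat by blast
  obtain k where k: "e = Suc k" using e by (cases e) auto
  \<comment> \<open>The truncated subtraction is exact, since \<open>e > v\<close> gives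
    \<open>v + 2 \<le> 3 * e\<close>.\<close>
  have "3 * e = (v + 2) + (3 * e - v - 2)" using e by simp
  then have "int l ^ (v + 2) * int C = int l ^ (v + 2) * (int l ^ (3 * e - v - 2) * X)"
    using X by (metis power_add mult.assoc)
  then show "int C = int l ^ (3 * e - v - 2) * X" using l2 by simp
  have P1: "real l > 1" using l2 by simp
  have "real_of_int (int (order (GL2_mod (int l ^ e))))
      = real_of_int (int l ^ (4 * k + 1) * (int l - 1) ^ 2 * (int l + 1))"
    unfolding k order_GL2_mod[OF l] ..
  then have G: "real (order (GL2_mod (int l ^ e))) = real l ^ (4 * k + 1) * (real l - 1) ^ 2 * (real l + 1)"
    by simp
  have "real_of_int (int l ^ (v + 2) * int C) = real_of_int (int l ^ (3 * e) * X)"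
    by (simp only: X)
  then have "real l ^ (v + 2) * real C = real l ^ (3 * k + 3) * real_of_int X"
    by (simp add: k add.commute)
  from density_algebra[OF P1 G this]
  show "real l ^ e * real C / real (order (GL2_mod (int l ^ e)))
      = real l * real_of_int X / (real l ^ v * (real l - 1) ^ 2 * (real l + 1))"
    by (simp only: k)
qed

lemma C_set_coprime:
  fixes l n N e :: nat
  assumes l: "prime l" and N: "N > 0" and u: "multiplicity l n = 0" and v: "multiplicity l N = 0" and e: "e > 0"
  shows "int (card (C_set N n l e)) =
      int l ^ (3 * (e - 1) + 1) * (int l ^ 2 - int l - 1 - symbol_sq (int N - 1) l)"
    and "real l ^ e * real (card (C_set N n l e)) / real (order (GL2_mod (int l ^ e))) =
      1 - (real_of_int (symbol_sq (int N - 1) l) * real l + 1) / ((real l - 1) ^ 2 * (real l + 1))"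
proof -
  define s where "s = symbol_sq (int N - 1) l"
  have l2: "l \<ge> 2" using l prime_ge_2_nat by blast
  obtain k where k: "e = Suc k" using e by (cases e) auto
  have "int l ^ (0 + 2) * int (card (C_set N n l e)) = int l ^ (3 * e) * ((int l + 1) * (int l - 1) - (int l + s))"
    using card_C_set_unramified[OF l N u, of k] v by (simp add: k s_def add.commute)
  note * = scaled_card_C_set[OF l e this]
  have "3 * e - 0 - 2 = 3 * (e - 1) + 1" using e by simp
  then show "int (card (C_set N n l e)) =
      int l ^ (3 * (e - 1) + 1) * (int l ^ 2 - int l - 1 - symbol_sq (int N - 1) l)"
    unfolding *(1) by (simp add: s_def algebra_simps power2_eq_square)
  \<comment> \<open>Both sides equal \<open>l ^ 3 - l ^ 2 - l - s * l\<close>; the first term on the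
    right cancels the denominator and yields the leading 1.\<close>
  have "real l * real_of_int ((int l + 1) * (int l - 1) - (int l + s))
      = (real l - 1) ^ 2 * (real l + 1) - (real_of_int s * real l + 1)"
    by (simp add: algebra_simps power2_eq_square)
  then show "real l ^ e * real (card (C_set N n l e)) / real (order (GL2_mod (int l ^ e))) =
      1 - (real_of_int (symbol_sq (int N - 1) l) * real l + 1) / ((real l - 1) ^ 2 * (real l + 1))"
    unfolding *(2) s_def[symmetric] using l2 by (simp add: diff_divide_distrib)
qed

text \<open>Since \<open>l\<close> divides \<open>N\<close>, it does not divide
  \<open>N - 1\<close>, so the symbol is 1. The subtracted term is then
  \<open>l ^ v * (l + 1)\<close>, and \<open>l + 1\<close> factors out.\<close>

lemma C_set_unramified:
  fixes l n N e v :: nat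
  assumes l: "prime l" and N: "N > 0" and u: "multiplicity l n = 0" and v: "v = multiplicity l N" "v \<ge> 1"
    and e: "e > v"
  shows "int (card (C_set N n l e)) =
      int l ^ (3 * e - v - 2) * (int l + 1) * (int l ^ (v + 1) - int l ^ v - 1)"
    and "real l ^ e * real (card (C_set N n l e)) / real (order (GL2_mod (int l ^ e))) =
      real l / (real l - 1) * (1 - 1 / (real l ^ v * (real l - 1)))"
proof -
  have l2: "l \<ge> 2" using l prime_ge_2_nat by blast
  obtain k where k: "e = Suc k" "v \<le> k" using e by (cases e) auto
  have "l dvd N" using v by (metis not_dvd_imp_multiplicity_0 not_one_le_zero)
  then have "int l dvd int N" by simp
  moreover have "\<not> int l dvd 1" using l2 by simp
  ultimately have "\<not> int l dvd int N - 1" by (metis dvd_diff_right_iff dvd_diff_left_iff)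
  then have s: "symbol_sq (int N - 1) l = 1" by (simp add: symbol_sq_def)
  have "int l ^ (v + 2) * int (card (C_set N n l e))
      = int l ^ (3 * e) * ((int l + 1) * (int l ^ (v + 1) - int l ^ v - 1))"
    using card_C_set_unramified[OF l N u, of k] k v by (simp add: s algebra_simps)
  note * = scaled_card_C_set[OF l e this]
  show "int (card (C_set N n l e)) =
      int l ^ (3 * e - v - 2) * (int l + 1) * (int l ^ (v + 1) - int l ^ v - 1)"
    unfolding *(1) by (simp only: mult.assoc)
  have "real_of_int ((int l + 1) * (int l ^ (v + 1) - int l ^ v - 1))
      = (real l + 1) * (real l ^ v * (real l - 1) - 1)"
    by (simp add: algebra_simps)
  then show "real l ^ e * real (card (C_set N n l e)) / real (order (GL2_mod (int l ^ e))) =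
      real l / (real l - 1) * (1 - 1 / (real l ^ v * (real l - 1)))"
    unfolding *(2) using l2 by (simp add: divide_simps power2_eq_square)
qed

lemma C_set_ramified:
  fixes l n N e u v :: nat
  assumes l: "prime l" and N: "N > 0" and u: "u = multiplicity l n" "1 \<le> u"
    and v: "v = multiplicity l N" and uv: "2 * u \<le> v" and e: "e > v"
  shows "int (card (C_set N n l e)) =
      int l ^ (3 * e - v - 2) * (int l + 1) * (int l ^ (v - 2 * u + 1) - 1)"
    and "real l ^ e * real (card (C_set N n l e)) / real (order (GL2_mod (int l ^ e))) =
      real l / (real l ^ (2 * u) * (real l - 1)) *
      ((real l ^ (v + 1) - real l ^ (2 * u)) / (real l ^ (v + 1) - real l ^ v - 1)) *
      (1 - 1 / (real l ^ v * (real l - 1)))"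
proof -
  have l2: "l \<ge> 2" using l prime_ge_2_nat by blast
  obtain k where k: "e = Suc k" "v \<le> k" using e by (cases e) auto
  have "int l ^ (v + 2) * int (card (C_set N n l e))
      = int l ^ (3 * e) * ((int l + 1) * (int l ^ (v - 2 * u + 1) - 1))"
    using card_C_set_ramified[OF l N, of n k] k u v uv by (simp add: mult.assoc add.commute)
  note * = scaled_card_C_set[OF l e this]
  show "int (card (C_set N n l e)) =
      int l ^ (3 * e - v - 2) * (int l + 1) * (int l ^ (v - 2 * u + 1) - 1)"
    unfolding *(1) by (simp only: mult.assoc)
  define P where "P = real l"
  define Y where "Y = P ^ (v - 2 * u + 1) - 1"
  \<comment> \<open>\<open>Z\<close> is the denominator of the middle factor of the density and the
    numerator of the last one, so it cancels once it is known to be nonzero.\<close>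
  define Z where "Z = P ^ v * (P - 1) - 1"
  have P1: "P > 1" using l2 by (simp add: P_def)
  then have nz: "P \<noteq> 0" "P - 1 \<noteq> 0" "P + 1 \<noteq> 0" by auto
  have "P ^ 1 < P ^ v" using P1 u uv by (intro power_strict_increasing) auto
  \<comment> \<open>\<open>v \<ge> 2\<close> excludes the zero denominator at \<open>l = 2\<close>, \<open>v = 0\<close>.\<close>
  moreover have "P - 1 \<ge> 1" using l2 by (simp add: P_def)
  ultimately have "1 * 1 < P ^ v * (P - 1)" using P1 by (intro mult_less_le_imp_less) auto
  then have Z0: "Z \<noteq> 0" by (simp add: Z_def)
  have Z: "P ^ (v + 1) - P ^ v - 1 = Z" by (simp add: Z_def algebra_simps)
  have Y: "P ^ (v + 1) - P ^ (2 * u) = P ^ (2 * u) * Y"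
    using uv by (simp add: Y_def right_diff_distrib flip: power_add)
  have W: "1 - 1 / (P ^ v * (P - 1)) = Z / (P ^ v * (P - 1))"
    using nz by (simp add: Z_def diff_divide_distrib)
  have X: "real_of_int ((int l + 1) * (int l ^ (v - 2 * u + 1) - 1)) = (P + 1) * Y"
    by (simp add: P_def Y_def)
  show "real l ^ e * real (card (C_set N n l e)) / real (order (GL2_mod (int l ^ e))) =
      real l / (real l ^ (2 * u) * (real l - 1)) *
      ((real l ^ (v + 1) - real l ^ (2 * u)) / (real l ^ (v + 1) - real l ^ v - 1)) *
      (1 - 1 / (real l ^ v * (real l - 1)))"
    unfolding *(2) X unfolding P_def[symmetric] Z Y W using nz Z0 by (simp add: power2_eq_square)
qed

theorem theoremA8:
  fixes l n N u v :: nat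
  assumes "prime l" and "n > 0" and "N > 0" and "n\<^sup>2 dvd N"
    and "u = multiplicity l n" and "v = multiplicity l N"
  shows
    "(\<forall>e>v.
        (u = 0 \<and> v = 0 \<longrightarrow>
           int (card (C_set N n l e)) =
             int l ^ (3 * (e - 1) + 1) * (int l ^ 2 - int l - 1 - symbol_sq (int N - 1) l)) \<and>
        (u = 0 \<and> v \<ge> 1 \<longrightarrow>
           int (card (C_set N n l e)) =
             int l ^ (3 * e - v - 2) * (int l + 1) * (int l ^ (v + 1) - int l ^ v - 1)) \<and>
        (1 \<le> u \<and> real u \<le> real v / 2 \<longrightarrow>
           int (card (C_set N n l e)) =
             int l ^ (3 * e - v - 2) * (int l + 1) * (int l ^ (v - 2 * u + 1) - 1)) \<and>
        (0 \<le> real v / 2 \<and> real v / 2 < real u \<longrightarrow>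
           int (card (C_set N n l e)) = 0)) \<and>
     (\<forall>e>v.
        (u = 0 \<and> v = 0 \<longrightarrow>
           real l ^ e * real (card (C_set N n l e)) / real (order (GL2_mod (int l ^ e))) =
             1 - (real_of_int (symbol_sq (int N - 1) l) * real l + 1) /
                 ((real l - 1) ^ 2 * (real l + 1))) \<and>
        (u = 0 \<and> v \<ge> 1 \<longrightarrow>
           real l ^ e * real (card (C_set N n l e)) / real (order (GL2_mod (int l ^ e))) =
             real l / (real l - 1) * (1 - 1 / (real l ^ v * (real l - 1)))) \<and>
        (1 \<le> u \<and> real u \<le> real v / 2 \<longrightarrow>
           real l ^ e * real (card (C_set N n l e)) / real (order (GL2_mod (int l ^ e))) =
             real l / (real l ^ (2 * u) * (real l - 1)) *
             ((real l ^ (v + 1) - real l ^ (2 * u)) / (real l ^ (v + 1) - real l ^ v - 1)) *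
             (1 - 1 / (real l ^ v * (real l - 1)))) \<and>
        (0 \<le> real v / 2 \<and> real v / 2 < real u \<longrightarrow>
           real l ^ e * real (card (C_set N n l e)) / real (order (GL2_mod (int l ^ e))) = 0))"
proof -
  have "multiplicity l (n\<^sup>2) \<le> multiplicity l N"
    using assms(3,4) by (intro dvd_imp_multiplicity_le) auto
  then have uv: "2 * u \<le> v"
    using assms by (simp add: prime_elem_multiplicity_power_distrib)
  then have half: "real v / 2 < real u \<longleftrightarrow> False" by simp
  note coprime = C_set_coprime[OF assms(1,3)]
    and unramified = C_set_unramified[OF assms(1,3) _ assms(6)]
    and ramified = C_set_ramified[OF assms(1,3) assms(5) _ assms(6) uv]
  show ?thesis
    using coprime unramified ramified assms(5,6) unfolding half by auto
qed

end
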